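(* Let $n,k\in\mathbb{N}$ with $n\ge k$, let $p\in[0,1]$, let $L>0$, let $X$ be an $n$-element set and let $V\subseteq X$ with $V\ne\emptyset$. (1) If $g\colon\binom{X}{k}\to[0,1]$ is a function with $w(g,p)=1$ such that every $S\in\langle g\rangle$ satisfies $|S\cap V|\ge\frac{ep}{L}|V|$, then there exists $G\subseteq 2^X\setminus\{\emptyset\}$ with $\langle g\rangle\subseteq\langle G\rangle$ and $w\left(G,\frac{p}{L}\right)\le 1$. (2) In particular, if $g\colon\binom{V}{k}\to[0,1]$ is a function which is constant on its support and satisfies $w(g,p)=1$ and $|\operatorname{supp}(g)|\ge\left(\frac{e^2}{L}\right)^k\binom{|V|}{k}$, then there exists $G\subseteq 2^X\setminus\{\emptyset\}$ with $\langle g\rangle\subseteq\langle G\rangle$ and $w\left(G,\frac{p}{L}\right)\le 1$.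
   Context: $\mathbb{N}=\{1,2,\dots\}$ and $e$ is Euler's number. For a finite set $X$, $2^X$ is its power set and $\binom{X}{k}$ is the set of $k$-element subsets of $X$. For a real $p\ge 0$, $G\subseteq 2^X$ and $g\colon 2^X\to[0,\infty)$ define $$w(G,p):=\sum_{T\in G}p^{|T|},\qquad w(g,p):=\sum_{T\in 2^X}g(T)\,p^{|T|},$$ $$\langle G\rangle:=\{S\in 2^X : \text{there is } T\in G \text{ with } T\subseteq S\},\qquad \langle g\rangle:=\Big\{S\in 2^X : \sum_{T\subseteq S}g(T)\ge 1\Big\}.$$ A function defined only on $\binom{X}{k}$ (or on $\binom{V}{k}$ with $V\subseteq X$) is regarded as a function on $2^X$ by setting it to $0$ elsewhere. The support of $g$ is $\operatorname{supp}(g):=\{S : g(S)\ne 0\}$. *)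

theory Defs
  imports Complex_Main "HOL-Library.FuncSet" "HOL-Library.Ramsey"
begin

text \<open>A function \<open>2\<^sup>X \<rightarrow> [0,\<infinity>)\<close> is represented by a total function on \<open>'a set\<close>, of which only the
  values on \<^term>\<open>Pow X\<close> are used. The \<open>k\<close>-element subsets of \<open>X\<close> are \<^term>\<open>nsets X k\<close>.\<close>

definition weight_fam :: "'a set set \<Rightarrow> real \<Rightarrow> real" where
  "weight_fam G p = (\<Sum>T\<in>G. p ^ card T)"

definition weight_fun :: "'a set \<Rightarrow> ('a set \<Rightarrow> real) \<Rightarrow> real \<Rightarrow> real" where
  "weight_fun X g p = (\<Sum>T\<in>Pow X. g T * p ^ card T)"

definition up_fam :: "'a set \<Rightarrow> 'a set set \<Rightarrow> 'a set set" where
  "up_fam X G = {S \<in> Pow X. \<exists>T\<in>G. T \<subseteq> S}"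

definition up_fun :: "'a set \<Rightarrow> ('a set \<Rightarrow> real) \<Rightarrow> 'a set set" where
  "up_fun X g = {S \<in> Pow X. (\<Sum>T\<in>Pow S. g T) \<ge> 1}"

definition supp :: "'a set \<Rightarrow> ('a set \<Rightarrow> real) \<Rightarrow> 'a set set" where
  "supp X g = {S \<in> Pow X. g S \<noteq> 0}"

definition zero_ext :: "'a set set \<Rightarrow> ('a set \<Rightarrow> real) \<Rightarrow> 'a set \<Rightarrow> real" where
  "zero_ext A g = (\<lambda>T. if T \<in> A then g T else 0)"

end

theory Submission
  imports Defs
begin

text \<open>Write \<open>m = |V|\<close>. If every member of an up-set meets \<open>V\<close> in at least \<open>e p m / L\<close> points, take
  \<open>r\<close> to be the ceiling of that number; the family of all \<open>r\<close>-subsets of \<open>V\<close> then covers the up-set,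
  and its weight at \<open>p / L\<close> is at most \<open>(m\<^sup>r / r!) (p / L)\<^sup>r \<le> (e m p / (L r))\<^sup>r \<le> 1\<close>, where
  \<open>r! \<ge> (r / e)\<^sup>r\<close> is used (lemma \<open>exists_cheap_cover\<close>). Because \<open>w(g,p) = 1\<close> with \<open>k \<ge> 1\<close> forces
  \<open>p > 0\<close>, one has \<open>r \<ge> 1\<close>, so the empty set is not among the covering sets. This is the first part.

  In the second part \<open>g\<close> equals a constant \<open>c\<close> on its support, hence \<open>c |supp g| p\<^sup>k = 1\<close>. A set \<open>S\<close>
  in the up-set of \<open>g\<close> with \<open>s = |S \<inter> V|\<close> contains at least \<open>1 / c\<close> members of the support, so
  \<open>(s choose k) \<ge> |supp g| p\<^sup>k \<ge> (e\<^sup>2 p / L)\<^sup>k (m choose k)\<close>. Since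
  \<open>(s choose k) / (m choose k) \<le> (s / m)\<^sup>k\<close>, this gives \<open>s \<ge> e\<^sup>2 p m / L \<ge> e p m / L\<close>, and the
  covering argument of the first part applies.\<close>

text \<open>The term of index \<open>r\<close> in the exponential series at \<open>r\<close> is at most the whole sum.\<close>

lemma power_self_le_exp_fact: "real r ^ r \<le> exp 1 ^ r * fact r"
proof -
  have "(\<Sum>n\<in>{r}. inverse (fact n) * real r ^ n) \<le> (\<Sum>n. inverse (fact n) * real r ^ n)"
    by (rule sum_le_suminf[OF summable_exp]) auto
  then have "inverse (fact r) * real r ^ r \<le> exp (real r)"
    by (simp add: exp_def divide_inverse mult.commute)
  also have "exp (real r) = exp 1 ^ r"
    by (simp flip: exp_of_nat_mult)
  finally show ?thesis
    by (simp add: field_simps)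
qed

lemma binomial_power_le_one:
  assumes "0 \<le> q" "exp 1 * q * real m \<le> real r"
  shows "real (m choose r) * q ^ r \<le> 1"
proof -
  have "real ((m choose r) * fact r) \<le> real (m ^ r)"
    by (intro of_nat_mono) (rule binomial_fact_pow)
  then have "(real (m choose r) * fact r) * (exp 1 * q) ^ r \<le> real m ^ r * (exp 1 * q) ^ r"
    using \<open>0 \<le> q\<close> by (intro mult_right_mono) simp_all
  then have "(real (m choose r) * q ^ r) * (exp 1 ^ r * fact r) \<le> (exp 1 * q * real m) ^ r"
    unfolding power_mult_distrib by (simp only: mult_ac)
  also have "\<dots> \<le> real r ^ r"
    using assms by (intro power_mono) auto
  also have "\<dots> \<le> 1 * (exp 1 ^ r * fact r)"
    using power_self_le_exp_fact[of r] by simp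
  finally show ?thesis
    by (rule mult_right_le_imp_le) simp
qed

text \<open>Termwise comparison \<open>(s - i) / (m - i) \<le> s / m\<close> of the factors of the two binomial
  coefficients; the induction multiplies these comparisons in cross-multiplied form.\<close>

lemma binomial_ratio_le_power:
  fixes s m k :: nat
  assumes "s \<le> m"
  shows "(s choose k) * m ^ k \<le> (m choose k) * s ^ k"
proof (induction k)
  case (Suc k)
  have absorb: "Suc k * (t choose Suc k) = (t - k) * (t choose k)" for t
    using binomial_absorption[of k t] binomial_absorb_comp[of t k] by simp
  have factor: "(s - k) * m \<le> (m - k) * s"
  proof -
    have "s * m - k * m \<le> m * s - k * s"
      unfolding mult.commute[of m s] by (rule diff_le_mono2) (simp add: assms)
    then show ?thesis
      by (simp only: diff_mult_distrib)
  qed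
  have "Suc k * ((s choose Suc k) * m ^ Suc k) = ((s - k) * m) * ((s choose k) * m ^ k)"
    unfolding power_Suc mult.assoc[symmetric] absorb by (simp only: mult_ac)
  also have "\<dots> \<le> ((m - k) * s) * ((m choose k) * s ^ k)"
    using factor Suc.IH by (rule mult_mono) auto
  also have "\<dots> = Suc k * ((m choose Suc k) * s ^ Suc k)"
    unfolding power_Suc mult.assoc[symmetric] absorb by (simp only: mult_ac)
  finally show ?case
    by (simp only: mult_le_cancel1)
qed simp

text \<open>The covering family consists of all \<open>r\<close>-subsets of \<open>V\<close>, where \<open>r\<close> is the least integer allowed
  by the intersection hypothesis; positivity of \<open>q\<close> keeps the empty set out of it.\<close>

lemma exists_cheap_cover:
  assumes "finite X" "V \<subseteq> X" "V \<noteq> {}" "0 < q" "F \<subseteq> Pow X"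
    and meets: "\<And>S. S \<in> F \<Longrightarrow> exp 1 * q * real (card V) \<le> real (card (S \<inter> V))"
  shows "\<exists>G \<subseteq> Pow X - {{}}. F \<subseteq> up_fam X G \<and> weight_fam G q \<le> 1"
proof -
  define r where "r = nat \<lceil>exp 1 * q * real (card V)\<rceil>"
  have finV: "finite V"
    using \<open>V \<subseteq> X\<close> \<open>finite X\<close> by (rule finite_subset)
  have "0 < exp 1 * q * real (card V)"
    using \<open>0 < q\<close> \<open>V \<noteq> {}\<close> finV by (simp add: card_gt_0_iff)
  then have "0 < r" and r_ge: "exp 1 * q * real (card V) \<le> real r"
    unfolding r_def by linarith+
  have "nsets V r \<subseteq> Pow X - {{}}"
    using \<open>0 < r\<close> \<open>V \<subseteq> X\<close> by (auto simp: nsets_def)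
  moreover have "F \<subseteq> up_fam X (nsets V r)"
  proof
    fix S assume "S \<in> F"
    then have "r \<le> card (S \<inter> V)"
      unfolding r_def using meets[of S] by linarith
    then obtain T where "T \<subseteq> S \<inter> V" "card T = r" "finite T"
      by (rule obtain_subset_with_card_n)
    then show "S \<in> up_fam X (nsets V r)"
      using \<open>S \<in> F\<close> \<open>F \<subseteq> Pow X\<close> by (auto simp: up_fam_def nsets_def)
  qed
  moreover have "weight_fam (nsets V r) q \<le> 1"
  proof -
    have "weight_fam (nsets V r) q = (\<Sum>T\<in>nsets V r. q ^ r)"
      unfolding weight_fam_def by (rule sum.cong) (auto simp: nsets_def)
    also have "\<dots> = real (card V choose r) * q ^ r"
      by (simp add: card_nsets)
    also have "\<dots> \<le> 1"
      using binomial_power_le_one[of q "card V" r] r_ge \<open>0 < q\<close> by simp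
    finally show ?thesis .
  qed
  ultimately show ?thesis
    by (intro exI[of _ "nsets V r"] conjI)
qed

text \<open>At \<open>p = 0\<close> only the empty set contributes to the weight, and it is not a \<open>k\<close>-set for \<open>k \<ge> 1\<close>.\<close>

lemma weight_fun_zero_ext_pos:
  assumes "0 \<le> p" "k \<ge> 1" "weight_fun X (zero_ext (nsets Y k) g) p = 1"
  shows "0 < p"
proof (rule ccontr)
  assume "\<not> 0 < p"
  then have "p = 0" using assms by simp
  then have "weight_fun X (zero_ext (nsets Y k) g) p = 0"
    unfolding weight_fun_def using \<open>k \<ge> 1\<close>
    by (intro sum.neutral) (auto simp: zero_ext_def nsets_def)
  with assms show False by simp
qed

text \<open>The weight condition determines the constant value \<open>c\<close> of \<open>g\<close> on its support by
  \<open>1 / c = |supp g| p\<^sup>k\<close>, and the values of \<open>g\<close> below \<open>S\<close> can sum to \<open>1\<close> only if \<open>S\<close> contains at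
  least \<open>1 / c\<close> of the \<open>k\<close>-subsets of \<open>V\<close>.\<close>

lemma supp_weight_le_choose:
  assumes "finite X" "V \<subseteq> X"
    and nonneg: "\<And>T. T \<in> nsets V k \<Longrightarrow> 0 \<le> g0 T"
    and g: "g = zero_ext (nsets V k) g0"
    and const: "\<forall>S \<in> supp X g. \<forall>T \<in> supp X g. g S = g T"
    and weight: "weight_fun X g p = 1"
    and "S \<in> up_fun X g"
  shows "real (card (supp X g)) * p ^ k \<le> real (card (S \<inter> V) choose k)"
proof -
  have supp_sub: "supp X g \<subseteq> nsets V k"
    by (auto simp: supp_def g zero_ext_def)
  have fin: "finite (Pow X)" "finite (nsets (S \<inter> V) k)"
    using assms finite_subset[of V X] by (auto intro!: finite_imp_finite_nsets)
  have S: "S \<subseteq> X" "1 \<le> (\<Sum>T\<in>Pow S. g T)"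
    using \<open>S \<in> up_fun X g\<close> by (auto simp: up_fun_def)
  have "supp X g \<noteq> {}"
  proof
    assume "supp X g = {}"
    then have "weight_fun X g p = 0"
      unfolding weight_fun_def by (intro sum.neutral) (auto simp: supp_def)
    with weight show False by simp
  qed
  then obtain T0 where T0: "T0 \<in> supp X g" by blast
  define c where "c = g T0"
  have c: "g T = c" if "T \<in> supp X g" for T
    using const T0 that unfolding c_def by blast
  have "0 < c"
    using T0 supp_sub nonneg[of T0] unfolding c_def by (auto simp: supp_def g zero_ext_def split: if_splits)
  have "weight_fun X g p = (\<Sum>T\<in>supp X g. g T * p ^ card T)"
    unfolding weight_fun_def using fin
    by (intro sum.mono_neutral_right) (auto simp: supp_def)
  also have "\<dots> = (\<Sum>T\<in>supp X g. c * p ^ k)"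
    using supp_sub c by (intro sum.cong) (auto simp: nsets_def)
  finally have weight_eq: "c * (real (card (supp X g)) * p ^ k) = 1"
    using weight by (simp add: mult_ac)
  have "(\<Sum>T\<in>Pow S. g T) = (\<Sum>T\<in>nsets (S \<inter> V) k. g T)"
    using S fin finite_subset[OF \<open>S \<subseteq> X\<close> \<open>finite X\<close>]
    by (intro sum.mono_neutral_right) (auto simp: nsets_def g zero_ext_def)
  also have "\<dots> \<le> (\<Sum>T\<in>nsets (S \<inter> V) k. c)"
  proof (rule sum_mono)
    fix T assume "T \<in> nsets (S \<inter> V) k"
    then have "T \<in> Pow X" using S by (auto simp: nsets_def)
    then show "g T \<le> c"
      using c[of T] \<open>0 < c\<close> by (cases "g T = 0") (auto simp: supp_def)
  qed
  also have "\<dots> = c * real (card (S \<inter> V) choose k)"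
    by (simp add: card_nsets)
  finally have "c * (real (card (supp X g)) * p ^ k) \<le> c * real (card (S \<inter> V) choose k)"
    using S weight_eq by simp
  then show ?thesis
    using \<open>0 < c\<close> by simp
qed

text \<open>Divide by \<open>m choose k\<close>, which is positive because \<open>k \<le> m\<close>: then \<open>a\<^sup>k \<le> (s / m)\<^sup>k\<close>, and
  \<open>k\<close>-th roots may be taken.\<close>

lemma le_of_binomial_ge:
  fixes a :: real
  assumes "0 \<le> a" "k \<ge> 1" "s \<le> m" "k \<le> m"
    and "a ^ k * real (m choose k) \<le> real (s choose k)"
  shows "a * real m \<le> real s"
proof -
  have "(a * real m) ^ k * real (m choose k) = (a ^ k * real (m choose k)) * real m ^ k"
    by (simp add: power_mult_distrib mult_ac)
  also have "\<dots> \<le> real (s choose k) * real m ^ k"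
    using assms by (intro mult_right_mono) auto
  also have "\<dots> \<le> real s ^ k * real (m choose k)"
    using of_nat_mono[OF binomial_ratio_le_power[OF \<open>s \<le> m\<close>, of k], where ?'a = real]
    by (simp add: mult.commute)
  finally have "(a * real m) ^ k \<le> real s ^ k"
    using \<open>k \<le> m\<close> by (simp add: mult_le_cancel_right)
  then show ?thesis
    using \<open>k \<ge> 1\<close> by (simp add: power_mono_iff assms(1))
qed

theorem proposition11:
  fixes n k :: nat and p L :: real and X V :: "'a set"
  assumes "n \<ge> 1" and "k \<ge> 1" and "n \<ge> k"
    and "p \<in> {0..1}" and "L > 0"
    and "finite X" and "card X = n"
    and "V \<subseteq> X" and "V \<noteq> {}"
  shows
    "(\<forall>g0 \<in> nsets X k \<rightarrow> {0..1::real}. \<forall>g. g = zero_ext (nsets X k) g0 \<longrightarrow>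
        weight_fun X g p = 1 \<longrightarrow>
        (\<forall>S \<in> up_fun X g. real (card (S \<inter> V)) \<ge> exp 1 * p / L * real (card V)) \<longrightarrow>
        (\<exists>G \<subseteq> Pow X - {{}}. up_fun X g \<subseteq> up_fam X G \<and> weight_fam G (p / L) \<le> 1))
   \<and> (\<forall>g0 \<in> nsets V k \<rightarrow> {0..1::real}. \<forall>g. g = zero_ext (nsets V k) g0 \<longrightarrow>
        (\<forall>S \<in> supp X g. \<forall>T \<in> supp X g. g S = g T) \<longrightarrow>
        weight_fun X g p = 1 \<longrightarrow>
        real (card (supp X g)) \<ge> ((exp 1)\<^sup>2 / L) ^ k * real (card V choose k) \<longrightarrow>
        (\<exists>G \<subseteq> Pow X - {{}}. up_fun X g \<subseteq> up_fam X G \<and> weight_fam G (p / L) \<le> 1))"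
proof (intro conjI ballI allI impI)
  have cover: "\<exists>G \<subseteq> Pow X - {{}}. up_fun X g \<subseteq> up_fam X G \<and> weight_fam G (p / L) \<le> 1"
    if "0 < p" "\<And>S. S \<in> up_fun X g \<Longrightarrow> exp 1 * p / L * real (card V) \<le> real (card (S \<inter> V))" for g
    using assms that by (intro exists_cheap_cover[of X V]) (auto simp: up_fun_def)
  {
    fix g0 g :: "'a set \<Rightarrow> real"
    assume g: "g = zero_ext (nsets X k) g0" and weight: "weight_fun X g p = 1"
      and "\<forall>S \<in> up_fun X g. exp 1 * p / L * real (card V) \<le> real (card (S \<inter> V))"
    moreover have "0 < p"
      using weight_fun_zero_ext_pos[of p k X X g0] assms g weight by simp
    ultimately show "\<exists>G \<subseteq> Pow X - {{}}. up_fun X g \<subseteq> up_fam X G \<and> weight_fam G (p / L) \<le> 1"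
      using cover by blast
  next
    fix g0 g :: "'a set \<Rightarrow> real"
    assume g0: "g0 \<in> nsets V k \<rightarrow> {0..1}" and g: "g = zero_ext (nsets V k) g0"
      and const: "\<forall>S \<in> supp X g. \<forall>T \<in> supp X g. g S = g T"
      and weight: "weight_fun X g p = 1"
      and large: "((exp 1)\<^sup>2 / L) ^ k * real (card V choose k) \<le> real (card (supp X g))"
    have nonneg: "0 \<le> g0 T" if "T \<in> nsets V k" for T
      using funcset_mem[OF g0 that] by simp
    have "0 < p"
      using weight_fun_zero_ext_pos[of p k X V g0] assms g weight by simp
    have finV: "finite V"
      using \<open>V \<subseteq> X\<close> \<open>finite X\<close> by (rule finite_subset)
    have "k \<le> card V"
    proof (rule ccontr)
      assume "\<not> k \<le> card V"
      then have "nsets V k = {}"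
        using finV by (auto simp: nsets_def dest: card_mono)
      then have "weight_fun X g p = 0"
        by (simp add: weight_fun_def g zero_ext_def)
      with weight show False by simp
    qed
    show "\<exists>G \<subseteq> Pow X - {{}}. up_fun X g \<subseteq> up_fam X G \<and> weight_fam G (p / L) \<le> 1"
    proof (rule cover[OF \<open>0 < p\<close>])
      fix S assume S: "S \<in> up_fun X g"
      have "((exp 1)\<^sup>2 * p / L) ^ k * real (card V choose k)
          = (((exp 1)\<^sup>2 / L) ^ k * real (card V choose k)) * p ^ k"
        by (simp add: power_mult_distrib power_divide)
      also have "\<dots> \<le> real (card (supp X g)) * p ^ k"
        using large \<open>0 < p\<close> by (intro mult_right_mono) auto
      also have "\<dots> \<le> real (card (S \<inter> V) choose k)"
        using supp_weight_le_choose[OF \<open>finite X\<close> \<open>V \<subseteq> X\<close> nonneg g const weight S] .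
      finally have "(exp 1)\<^sup>2 * p / L * real (card V) \<le> real (card (S \<inter> V))"
        using \<open>k \<ge> 1\<close> \<open>0 < p\<close> \<open>L > 0\<close> \<open>k \<le> card V\<close>
        by - (rule le_of_binomial_ge[where k = k],
          simp_all add: card_mono[OF finV])
      moreover have "exp 1 * p / L * real (card V) \<le> (exp 1)\<^sup>2 * p / L * real (card V)"
        using \<open>0 < p\<close> \<open>L > 0\<close>
        by (intro mult_right_mono divide_right_mono) (auto simp: power2_eq_square)
      ultimately show "exp 1 * p / L * real (card V) \<le> real (card (S \<inter> V))"
        by linarith
    qed
  }
qed

end
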